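(* Let $N$ be a squarefree positive integer and let $\{f_j\}_{j\ge 1}$ be the Maass newforms of level $N$ with trivial character, with Laplace eigenvalues $0<\lambda_1\le\lambda_2\le\cdots$ and Hecke eigenvalues $a_j(n)$. Let $M\ge 1$ and let $H:(0,\infty)\to[0,\infty)$ be an admissible test function. Let $Q$ and $\widetilde{Q}$ be the symmetric matrices (indexed by the integers $1\le m\le M$ with $\gcd(m,N)=1$) of the quadratic forms $c\mapsto Q(c,H)$ and $c\mapsto Q(c,\widetilde{H})$, where $\widetilde{H}(\lambda)=\lambda H(\lambda)$, and suppose that $Q$ is positive definite. Let $\widetilde{\lambda}_i\in\mathbb{R}$ be a solution of the generalised eigenvalue problem $\widetilde{Q}x=\lambda Qx$ with corresponding eigenvector $x=c_i\neq 0$, regarded as a real sequence $\{c_i(m)\}_{m=1}^{M}$ by setting $c_i(m)=0$ when $\gcd(m,N)>1$. Put $\widetilde{H}_i(\lambda)=H(\lambda)(\lambda-\widetilde{\lambda}_i)^2$ and $$\varepsilon_i=\sqrt{\frac{Q(c_i,\widetilde{H}_i)}{Q(c_i,H)}}.$$ Then there exists a cuspidal eigenvalue $\lambda\in\{\lambda_j: j\ge 1\}$ with $\lambda\in[\widetilde{\lambda}_i-\varepsilon_i,\ \widetilde{\lambda}_i+\varepsilon_i]$.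
   Context: A Maass cusp form (weight $0$) for $\Gamma_0(N)$ is a non-constant smooth $\Gamma_0(N)$-invariant function on the upper half-plane that lies in $L^2(\Gamma_0(N)\backslash\mathbb{H})$, vanishes at the cusps, and is an eigenfunction of $\Delta=-y^2(\partial_x^2+\partial_y^2)$. Newforms are those in the orthogonal complement (for the Petersson inner product) of the span of the oldforms $f(kz)$, with $f$ a form for $\Gamma_0(K)$, $K\mid N$, $K<N$, $k\mid N/K$. The sequence $\{f_j\}_{j\ge1}$ is a basis, consisting of Hecke eigenforms normalised by $a_j(1)=1$, of the direct sum over $\lambda>0$ of the spaces of Maass newforms of level $N$, trivial character and Laplace eigenvalue $\lambda$; $\lambda_j$ is the Laplace eigenvalue of $f_j$, and $a_j(n)\in\mathbb{R}$ is defined by $T_nf_j=a_j(n)f_j$, where for $n>0$ $$T_nf(z)=\frac{1}{\sqrt{n}}\sum_{\substack{ad=n,\ d>0\\ \gcd(a,N)=1}}\ \sum_{b=0}^{d-1}f\Big(\frac{az+b}{d}\Big).$$ For a function $H$ on $(0,\infty)$ and a real sequence $c=\{c(m)\}_{m=1}^M$ with $c(m)=0$ whenever $\gcd(m,N)>1$, define $$Q(c,H)=\sum_{j=1}^\infty\Big(\sum_{m=1}^M c(m)a_j(m)\Big)^2H(\lambda_j).$$ "Admissible" means that $H(\lambda)$ decays fast enough that the series $\sum_j a_j(n)H(\lambda_j)$, $\sum_j a_j(n)\lambda_jH(\lambda_j)$ and $\sum_j a_j(n)\lambda_j^2H(\lambda_j)$ converge absolutely for all $n\ge1$ with $\gcd(n,N)=1$.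 *)

theory Defs
  imports
    "HOL-Analysis.Analysis"
    "HOL-Computational_Algebra.Squarefree"
    "HOL-Library.Function_Algebras"
begin

text \<open>
  A function on the upper half-plane is represented by a function \<^typ>\<open>complex \<Rightarrow> complex\<close> that is
  \<open>0\<close> off the upper half-plane.  This makes the representing function unique, so that linear
  independence and spans may be taken in the complex vector space \<^typ>\<open>complex \<Rightarrow> complex\<close>.
\<close>

definition upper_half_plane :: "complex set" (\<open>\<H>\<close>) where
  "\<H> = {z. Im z > 0}"

definition Gamma0 :: "nat \<Rightarrow> (int^2^2) set" where
  "Gamma0 N = {A. det A = 1 \<and> int N dvd A $ 2 $ 1}"

definition moebius :: "int^2^2 \<Rightarrow> complex \<Rightarrow> complex" where
  "moebius A z = (of_int (A $ 1 $ 1) * z + of_int (A $ 1 $ 2)) /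
                 (of_int (A $ 2 $ 1) * z + of_int (A $ 2 $ 2))"


subsection \<open>Smooth functions and the hyperbolic Laplacian\<close>

primrec higher_differentiable_on ::
  "nat \<Rightarrow> 'a::real_normed_vector set \<Rightarrow> ('a \<Rightarrow> 'b::real_normed_vector) \<Rightarrow> bool" where
  "higher_differentiable_on 0 S f \<longleftrightarrow> continuous_on S f"
| "higher_differentiable_on (Suc k) S f \<longleftrightarrow>
     (\<forall>x\<in>S. f differentiable (at x)) \<and>
     (\<forall>v. higher_differentiable_on k S (\<lambda>x. frechet_derivative f (at x) v))"

text \<open>Derivatives are over \<open>\<real>\<close>, also for \<^typ>\<open>complex\<close>; \<open>S\<close> is meant to be open.\<close>

definition smooth_on :: "'a::real_normed_vector set \<Rightarrow> ('a \<Rightarrow> 'b::real_normed_vector) \<Rightarrow> bool" where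
  "smooth_on S f \<longleftrightarrow> (\<forall>k. higher_differentiable_on k S f)"

definition partial_x :: "(complex \<Rightarrow> complex) \<Rightarrow> complex \<Rightarrow> complex" where
  "partial_x f z = frechet_derivative f (at z) 1"

definition partial_y :: "(complex \<Rightarrow> complex) \<Rightarrow> complex \<Rightarrow> complex" where
  "partial_y f z = frechet_derivative f (at z) \<i>"

definition hyp_laplacian :: "(complex \<Rightarrow> complex) \<Rightarrow> complex \<Rightarrow> complex" where
  "hyp_laplacian f z =
     - (of_real (Im z))\<^sup>2 * (partial_x (partial_x f) z + partial_y (partial_y f) z)"


subsection \<open>Integration over the quotient\<close>

definition hyp_measure :: "complex measure" where
  "hyp_measure = density lborel (\<lambda>z. ennreal (indicator \<H> z / (Im z)\<^sup>2))"

text \<open>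
  The Ford fundamental domain of \<open>\<Gamma>\<^sub>0(N)\<close>: points of greatest height in their orbit, modulo the
  translations by integers, which are the stabiliser of \<open>\<infinity>\<close> up to sign.  The heights of the points
  of an orbit attain their maximum, so the domain meets every orbit; two different points of it lie
  in the same orbit only if they lie on one of the countably many circles \<open>\<bar>c z + d\<bar> = 1\<close>.
\<close>

definition fundamental_domain :: "nat \<Rightarrow> complex set" where
  "fundamental_domain N =
     {z \<in> \<H>. 0 \<le> Re z \<and> Re z < 1 \<and> (\<forall>A\<in>Gamma0 N. Im (moebius A z) \<le> Im z)}"

definition petersson :: "nat \<Rightarrow> (complex \<Rightarrow> complex) \<Rightarrow> (complex \<Rightarrow> complex) \<Rightarrow> complex" where
  "petersson N f g =
     set_lebesgue_integral hyp_measure (fundamental_domain N) (\<lambda>z. f z * cnj (g z))"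


subsection \<open>Maass cusp forms\<close>

text \<open>
  The cusps of \<open>\<Gamma>\<^sub>0(N)\<close> are the points \<open>A \<infinity>\<close> for \<open>A \<in> SL\<^sub>2(\<int>) = \<Gamma>\<^sub>0(1)\<close>.  The limit is
  along \<open>Im z \<rightarrow> \<infinity>\<close>, uniformly in \<open>Re z\<close>.
\<close>

definition vanishes_at_cusps :: "(complex \<Rightarrow> complex) \<Rightarrow> bool" where
  "vanishes_at_cusps f \<longleftrightarrow>
     (\<forall>A\<in>Gamma0 1. ((\<lambda>z. f (moebius A z)) \<longlongrightarrow> 0) (filtercomap Im at_top))"

definition maass_cusp_form :: "nat \<Rightarrow> complex \<Rightarrow> (complex \<Rightarrow> complex) \<Rightarrow> bool" where
  "maass_cusp_form N lam f \<longleftrightarrow>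
     (\<forall>z. z \<notin> \<H> \<longrightarrow> f z = 0) \<and>
     \<not> (\<exists>k. \<forall>z\<in>\<H>. f z = k) \<and>
     smooth_on \<H> f \<and>
     (\<forall>A\<in>Gamma0 N. \<forall>z\<in>\<H>. f (moebius A z) = f z) \<and>
     set_integrable hyp_measure (fundamental_domain N) (\<lambda>z. (cmod (f z))\<^sup>2) \<and>
     vanishes_at_cusps f \<and>
     (\<forall>z\<in>\<H>. hyp_laplacian f z = lam * f z)"

definition scale_fun :: "complex \<Rightarrow> (complex \<Rightarrow> complex) \<Rightarrow> complex \<Rightarrow> complex" where
  "scale_fun c f = (\<lambda>z. c * f z)"

global_interpretation fun_space: vector_space scale_fun
  by unfold_locales (auto simp: scale_fun_def plus_fun_def algebra_simps)

definition oldforms :: "nat \<Rightarrow> (complex \<Rightarrow> complex) set" where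
  "oldforms N =
     {(\<lambda>z. g (of_nat k * z)) | g k K lam.
        K dvd N \<and> K < N \<and> k dvd N div K \<and> maass_cusp_form K lam g}"

definition newform_space :: "nat \<Rightarrow> real \<Rightarrow> (complex \<Rightarrow> complex) set" where
  "newform_space N lam =
     {f. (f = 0 \<or> maass_cusp_form N (of_real lam) f) \<and>
         (\<forall>g \<in> fun_space.span (oldforms N). petersson N f g = 0)}"

definition hecke :: "nat \<Rightarrow> nat \<Rightarrow> (complex \<Rightarrow> complex) \<Rightarrow> complex \<Rightarrow> complex" where
  "hecke N n f z =
     1 / of_real (sqrt (real n)) *
     (\<Sum>(a, d) \<in> {(a, d). a * d = n \<and> d > 0 \<and> coprime a N}.
        \<Sum>b<d. f ((of_nat a * z + of_nat b) / of_nat d))"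

text \<open>
  Sequences are indexed from \<open>0\<close>: \<open>f j\<close>, \<open>lam j\<close>, \<open>a j\<close> are the customary \<open>f\<^sub>j\<^sub>+\<^sub>1\<close>, \<open>\<lambda>\<^sub>j\<^sub>+\<^sub>1\<close>,
  \<open>a\<^sub>j\<^sub>+\<^sub>1\<close>.  Eigenfunctions of the Laplacian with different eigenvalues are linearly independent, so
  the span of the union below is the direct sum of the newform spaces.
\<close>

definition maass_newform_basis ::
  "nat \<Rightarrow> (nat \<Rightarrow> complex \<Rightarrow> complex) \<Rightarrow> (nat \<Rightarrow> real) \<Rightarrow> (nat \<Rightarrow> nat \<Rightarrow> real) \<Rightarrow> bool" where
  "maass_newform_basis N f lam a \<longleftrightarrow>
     (\<forall>j. lam j > 0 \<and> f j \<in> newform_space N (lam j)) \<and>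
     mono lam \<and>
     inj f \<and> fun_space.independent (range f) \<and>
     fun_space.span (range f) = fun_space.span (\<Union>\<mu>\<in>{0<..}. newform_space N \<mu>) \<and>
     (\<forall>j. \<forall>n\<ge>1. hecke N n (f j) = scale_fun (of_real (a j n)) (f j)) \<and>
     (\<forall>j. a j 1 = 1)"


subsection \<open>The quadratic forms\<close>

definition admissible ::
  "nat \<Rightarrow> (nat \<Rightarrow> real) \<Rightarrow> (nat \<Rightarrow> nat \<Rightarrow> real) \<Rightarrow> (real \<Rightarrow> real) \<Rightarrow> bool" where
  "admissible N lam a H \<longleftrightarrow>
     (\<forall>n\<ge>1. coprime n N \<longrightarrow>
        summable (\<lambda>j. \<bar>a j n * H (lam j)\<bar>) \<and>
        summable (\<lambda>j. \<bar>a j n * lam j * H (lam j)\<bar>) \<and>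
        summable (\<lambda>j. \<bar>a j n * (lam j)\<^sup>2 * H (lam j)\<bar>))"

definition quad_form ::
  "(nat \<Rightarrow> real) \<Rightarrow> (nat \<Rightarrow> nat \<Rightarrow> real) \<Rightarrow> nat \<Rightarrow> (nat \<Rightarrow> real) \<Rightarrow> (real \<Rightarrow> real) \<Rightarrow> real" where
  "quad_form lam a M c H = (\<Sum>j. (\<Sum>m=1..M. c m * a j m)\<^sup>2 * H (lam j))"

definition index_set :: "nat \<Rightarrow> nat \<Rightarrow> nat set" where
  "index_set N M = {m \<in> {1..M}. coprime m N}"

text \<open>
  Matrices with rows and columns indexed by a finite set \<open>I\<close> are functions of two arguments of which
  only the values on \<open>I\<close> matter; vectors indexed by \<open>I\<close> are extended by \<open>0\<close>.
\<close>

definition symmetric_matrix_of_form ::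
  "nat set \<Rightarrow> ((nat \<Rightarrow> real) \<Rightarrow> real) \<Rightarrow> (nat \<Rightarrow> nat \<Rightarrow> real) \<Rightarrow> bool" where
  "symmetric_matrix_of_form I q A \<longleftrightarrow>
     (\<forall>m\<in>I. \<forall>n\<in>I. A m n = A n m) \<and>
     (\<forall>c. (\<forall>m. m \<notin> I \<longrightarrow> c m = 0) \<longrightarrow> q c = (\<Sum>m\<in>I. \<Sum>n\<in>I. c m * A m n * c n))"

definition positive_definite :: "nat set \<Rightarrow> (nat \<Rightarrow> nat \<Rightarrow> real) \<Rightarrow> bool" where
  "positive_definite I A \<longleftrightarrow>
     (\<forall>x. (\<exists>m\<in>I. x m \<noteq> 0) \<longrightarrow> (\<Sum>m\<in>I. \<Sum>n\<in>I. x m * A m n * x n) > 0)"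

definition generalised_eigenpair ::
  "nat set \<Rightarrow> (nat \<Rightarrow> nat \<Rightarrow> real) \<Rightarrow> (nat \<Rightarrow> nat \<Rightarrow> real) \<Rightarrow> real \<Rightarrow> (nat \<Rightarrow> real) \<Rightarrow> bool" where
  "generalised_eigenpair I B A \<mu> x \<longleftrightarrow>
     (\<exists>m\<in>I. x m \<noteq> 0) \<and>
     (\<forall>m\<in>I. (\<Sum>n\<in>I. B m n * x n) = \<mu> * (\<Sum>n\<in>I. A m n * x n))"

end

theory Submission
  imports Defs
begin

text \<open>
  Write \<open>w\<^sub>j\<close> for \<open>(\<Sum>m. c(m) a\<^sub>j(m))\<^sup>2 H(\<lambda>\<^sub>j)\<close>, which is nonnegative.  Then \<open>\<epsilon>\<^sup>2\<close> is the average of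
  \<open>(\<lambda>\<^sub>j - \<lambda>')\<^sup>2\<close> with respect to the weights \<open>w\<^sub>j\<close>, where \<open>\<lambda>'\<close> is the approximate eigenvalue.  An
  average of numbers cannot be smaller than all of them, so some \<open>\<lambda>\<^sub>j\<close> is within \<open>\<epsilon>\<close> of \<open>\<lambda>'\<close>
  (\<open>exists_within_rms_deviation\<close>).  Positive definiteness of \<open>Q\<close> is what makes the total weight
  \<open>Q(c, H)\<close> positive.

  This needs convergence of \<open>\<Sum>j. w\<^sub>j\<close> and of \<open>\<Sum>j. w\<^sub>j (\<lambda>\<^sub>j - \<lambda>')\<^sup>2\<close>, which contain products
  \<open>a\<^sub>j(m) a\<^sub>j(n)\<close>, whereas admissibility speaks of single coefficients.  Hecke multiplicativity
  would reduce the products to single coefficients.  The argument here instead uses that, for fixed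
  \<open>n\<close>, the numbers \<open>a\<^sub>j(n)\<close> are bounded uniformly in \<open>j\<close> (\<open>basis_hecke_eigenvalue_bound\<close>), so that
  admissibility at \<open>n = 1\<close>, where \<open>a\<^sub>j(1) = 1\<close>, suffices.  For this bound, note that \<open>T\<^sub>n f(z)\<close> is
  \<open>1 / \<surd>n\<close> times a sum of values of \<open>f\<close> on \<open>\<H>\<close> whose number depends only on \<open>n\<close> and \<open>N\<close>.  So the
  operator norm of \<open>T\<^sub>n\<close> for the supremum norm is finite, and it bounds the absolute value of every
  eigenvalue that has a bounded nonzero eigenfunction.

  That cusp forms are bounded (\<open>maass_cusp_form_bounded\<close>) is reduction theory.  Every point of \<open>\<H>\<close> is
  carried by \<open>SL\<^sub>2(\<int>)\<close> into a Siegel set, and for \<open>\<Gamma>\<^sub>0(N)\<close>-invariant \<open>f\<close> there are only finitely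
  many functions \<open>f \<circ> A\<close> with \<open>A \<in> SL\<^sub>2(\<int>)\<close>.  Each of them is bounded on the Siegel set, high up
  because \<open>f\<close> vanishes at the cusp, and below by compactness.
\<close>

section \<open>Weighted averages\<close>

lemma exists_within_rms_deviation:
  fixes w x :: "nat \<Rightarrow> real" and t :: real
  assumes w: "\<And>j. w j \<ge> 0" and sw: "summable w"
    and sv: "summable (\<lambda>j. w j * (x j - t)\<^sup>2)" and pos: "suminf w > 0"
  shows "\<exists>j. \<bar>x j - t\<bar> \<le> sqrt ((\<Sum>j. w j * (x j - t)\<^sup>2) / suminf w)"
proof (rule ccontr)
  define V where "V = (\<Sum>j. w j * (x j - t)\<^sup>2)"
  define e where "e = sqrt (V / suminf w)"
  assume "\<not> ?thesis"
  then have far: "e < \<bar>x j - t\<bar>" for j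
    by (auto simp: e_def V_def not_le)
  have "V \<ge> 0"
    unfolding V_def using w by (intro suminf_nonneg sv) simp
  then have e0: "e \<ge> 0" and e2: "e\<^sup>2 * suminf w = V"
    using pos by (auto simp: e_def)
  have gap: "(x j - t)\<^sup>2 - e\<^sup>2 > 0" for j
    using power_strict_mono[OF far[of j] e0, of 2] by simp
  obtain i where "w i \<noteq> 0"
    using pos by (metis less_irrefl suminf_zero ext)
  then have "w i > 0"
    using w[of i] by simp
  \<comment> \<open>The terms of \<open>V - e\<^sup>2 \<Sum>w\<close>, which is \<open>0\<close>, would be nonnegative and not all \<open>0\<close>.\<close>
  define g where "g = (\<lambda>j. w j * (x j - t)\<^sup>2 - e\<^sup>2 * w j)"
  have g: "g j = w j * ((x j - t)\<^sup>2 - e\<^sup>2)" for j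
    by (simp add: g_def algebra_simps)
  have "summable g"
    unfolding g_def by (intro summable_diff sv summable_mult sw)
  moreover have "g j \<ge> 0" for j
    using w[of j] gap[of j] by (simp add: g)
  moreover have "g i > 0"
    using \<open>w i > 0\<close> gap[of i] by (simp add: g)
  ultimately have "suminf g > 0"
    by (intro suminf_pos2)
  moreover have "suminf g = V - e\<^sup>2 * suminf w"
    unfolding g_def V_def by (simp add: suminf_diff[symmetric] suminf_mult sv sw summable_mult)
  ultimately show False
    using e2 by simp
qed

section \<open>The action of the modular group\<close>

definition mat2 :: "int \<Rightarrow> int \<Rightarrow> int \<Rightarrow> int \<Rightarrow> int^2^2" where
  "mat2 p q r s = vector [vector [p, q], vector [r, s]]"

lemma mat2_nth [simp]:
  "mat2 p q r s $ 1 $ 1 = p" "mat2 p q r s $ 1 $ 2 = q"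
  "mat2 p q r s $ 2 $ 1 = r" "mat2 p q r s $ 2 $ 2 = s"
  by (simp_all add: mat2_def)

lemma det_mat2 [simp]: "det (mat2 p q r s) = p * s - q * r"
  by (simp add: det_2)

definition adj2 :: "int^2^2 \<Rightarrow> int^2^2" where
  "adj2 A = mat2 (A $ 2 $ 2) (- A $ 1 $ 2) (- A $ 2 $ 1) (A $ 1 $ 1)"

lemma det_adj2: "det (adj2 A) = det A"
  by (simp add: adj2_def det_2)

lemma adj2_mult: "det A = 1 \<Longrightarrow> adj2 A ** A = mat 1"
  by (simp add: adj2_def vec_eq_iff forall_2 matrix_matrix_mult_def sum_2 mat_def det_2 mult.commute)

lemma Gamma0_1_iff: "A \<in> Gamma0 1 \<longleftrightarrow> det A = 1"
  by (simp add: Gamma0_def)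

lemma moebius_denom_nonzero:
  fixes A :: "int^2^2"
  assumes "det A = 1" "z \<in> \<H>"
  shows "of_int (A $ 2 $ 1) * z + of_int (A $ 2 $ 2) \<noteq> (0 :: complex)"
proof
  assume *: "of_int (A $ 2 $ 1) * z + of_int (A $ 2 $ 2) = (0 :: complex)"
  from arg_cong[OF this, of Im] have "A $ 2 $ 1 = 0"
    using assms by (simp add: upper_half_plane_def)
  moreover from this * have "A $ 2 $ 2 = 0"
    by simp
  ultimately show False
    using assms by (simp add: det_2)
qed

lemma Im_moebius:
  assumes "det A = 1"
  shows "Im (moebius A z) = Im z / (cmod (of_int (A $ 2 $ 1) * z + of_int (A $ 2 $ 2)))\<^sup>2"
proof -
  have "Im z * (of_int (A $ 1 $ 1) * of_int (A $ 2 $ 2) - of_int (A $ 1 $ 2) * of_int (A $ 2 $ 1))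
        = Im z"
    using arg_cong[OF assms, of real_of_int] by (simp add: det_2)
  then show ?thesis
    by (simp add: moebius_def Im_divide cmod_power2 algebra_simps)
qed

lemma moebius_in_upper_half_plane:
  assumes "det A = 1" "z \<in> \<H>"
  shows "moebius A z \<in> \<H>"
  using moebius_denom_nonzero[OF assms] assms Im_moebius[OF assms(1), of z]
  by (simp add: upper_half_plane_def)

lemma moebius_mult:
  assumes "det B = 1" "z \<in> \<H>" and "det A = 1"
  shows "moebius (A ** B) z = moebius A (moebius B z)"
proof -
  define u where "u = of_int (B $ 1 $ 1) * z + of_int (B $ 1 $ 2)"
  define v where "v = of_int (B $ 2 $ 1) * z + of_int (B $ 2 $ 2)"
  have v: "v \<noteq> 0"
    using moebius_denom_nonzero[OF assms(1,2)] by (simp add: v_def)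
  have 1: "moebius (A ** B) z = (of_int (A $ 1 $ 1) * u + of_int (A $ 1 $ 2) * v) /
             (of_int (A $ 2 $ 1) * u + of_int (A $ 2 $ 2) * v)"
    by (simp add: moebius_def matrix_matrix_mult_def sum_2 u_def v_def algebra_simps)
  have "p * (u / v) + q = (p * u + q * v) / v" for p q
    using v by (simp add: field_simps)
  then have "moebius A (moebius B z) = ((of_int (A $ 1 $ 1) * u + of_int (A $ 1 $ 2) * v) / v) /
             ((of_int (A $ 2 $ 1) * u + of_int (A $ 2 $ 2) * v) / v)"
    by (simp add: moebius_def u_def[symmetric] v_def[symmetric])
  then show ?thesis
    using v 1 by simp
qed

lemma moebius_adj2:
  assumes "det A = 1" "z \<in> \<H>"
  shows "moebius (adj2 A) (moebius A z) = z"
proof -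
  have "moebius (adj2 A) (moebius A z) = moebius (mat 1) z"
    using moebius_mult[of A z "adj2 A"] assms by (simp add: det_adj2 adj2_mult)
  then show ?thesis
    by (simp add: moebius_def mat_def)
qed

section \<open>Reduction theory\<close>

lemma finite_lattice_points:
  assumes "z \<in> \<H>"
  shows "finite {(m, n). cmod (of_int m * z + of_int n) \<le> R}"
proof -
  have y: "Im z > 0"
    using assms by (simp add: upper_half_plane_def)
  define C where "C = \<lceil>R / Im z\<rceil>"
  define D where "D = \<lceil>R + of_int C * cmod z\<rceil>"
  have "{(m, n). cmod (of_int m * z + of_int n) \<le> R} \<subseteq> {-C..C} \<times> {-D..D}"
  proof safe
    fix m n assume le: "cmod (of_int m * z + of_int n) \<le> R"
    have "\<bar>of_int m\<bar> * Im z \<le> R"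
      using abs_Im_le_cmod[of "of_int m * z + of_int n"] le y by (simp add: abs_mult)
    then have "\<bar>of_int m\<bar> \<le> R / Im z"
      using y by (simp add: field_simps)
    then have m: "\<bar>m\<bar> \<le> C"
      unfolding C_def by linarith
    have "cmod (of_int n) \<le> cmod (of_int m * z + of_int n) + cmod (of_int m * z)"
      using norm_triangle_ineq4[of "of_int m * z + of_int n" "of_int m * z"] by simp
    also have "\<dots> \<le> R + of_int C * cmod z"
      using le m by (auto simp: norm_mult intro!: add_mono mult_right_mono)
    finally have "\<bar>n\<bar> \<le> D"
      unfolding D_def by (simp, linarith)
    with m show "m \<in> {-C..C}" "n \<in> {-D..D}"
      by auto
  qed
  then show ?thesis
    by (rule finite_subset) simp
qed

text \<open>
  By \<open>Im_moebius\<close>, the highest point of an orbit belongs to a bottom row \<open>(m, n)\<close> that minimises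
  \<open>\<bar>m z + n\<bar>\<close>; the identity matrix has the value \<open>1\<close>, so finitely many rows compete.
\<close>

lemma exists_highest_translate:
  assumes "z \<in> \<H>"
  obtains B where "det B = 1" "\<And>A. det A = 1 \<Longrightarrow> Im (moebius A z) \<le> Im (moebius B z)"
proof -
  define h where "h = (\<lambda>(m, n). cmod (of_int m * z + of_int n))"
  define row where "row = (\<lambda>A :: int^2^2. (A $ 2 $ 1, A $ 2 $ 2))"
  define P where "P = {p \<in> row ` {A. det A = 1}. h p \<le> 1}"
  have "finite P"
    by (rule finite_subset[OF _ finite_lattice_points[OF assms, of 1]]) (auto simp: P_def h_def)
  have one: "(0, 1) \<in> P"
    by (auto simp: P_def h_def row_def image_iff intro!: exI[of _ "mat2 1 0 0 1"])
  then have "P \<noteq> {}"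
    by auto
  define p where "p = arg_min_on h P"
  have "p \<in> P"
    using arg_min_if_finite(1)[OF \<open>finite P\<close> \<open>P \<noteq> {}\<close>] by (simp add: p_def)
  have least: "h p \<le> h q" if "q \<in> P" for q
    using arg_min_least[OF \<open>finite P\<close> \<open>P \<noteq> {}\<close> that] by (simp add: p_def)
  from \<open>p \<in> P\<close> obtain B where B: "det B = 1" "p = row B"
    by (auto simp: P_def)
  have "Im (moebius A z) \<le> Im (moebius B z)" if A: "det A = 1" for A
  proof -
    have "h (row B) \<le> h (row A)"
      using least[of "row A"] A B \<open>p \<in> P\<close> by (cases "h (row A) \<le> 1") (auto simp: P_def)
    moreover have "h (row B) > 0"
      using moebius_denom_nonzero[OF B(1) assms] by (simp add: h_def row_def)
    ultimately have "Im z / (h (row A))\<^sup>2 \<le> Im z / (h (row B))\<^sup>2"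
      using assms by (intro divide_left_mono power_mono mult_pos_pos zero_less_power)
        (auto simp: upper_half_plane_def)
    then show ?thesis
      using A B by (simp add: Im_moebius h_def row_def)
  qed
  then show ?thesis
    using B that by blast
qed

text \<open>
  The height \<open>1/2\<close> is not sharp: the set still meets every orbit with \<open>\<surd>3/2\<close> in its place.  Any
  positive height up to \<open>\<surd>3/2\<close> would do, because all that matters besides is that the part of the
  set below a given height is compact in \<open>\<H>\<close>.
\<close>

definition siegel_set :: "complex set" where
  "siegel_set = {w. \<bar>Re w\<bar> \<le> 1/2 \<and> Im w \<ge> 1/2}"

lemma siegel_set_subset: "siegel_set \<subseteq> \<H>"
  by (auto simp: siegel_set_def upper_half_plane_def)

text \<open>
  Shift a highest point of the orbit into the strip \<open>\<bar>Re w\<bar> \<le> 1/2\<close>.  The inversion \<open>w \<mapsto> -1/w\<close>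
  divides the height by \<open>\<bar>w\<bar>\<^sup>2\<close> and cannot increase it, so \<open>\<bar>w\<bar> \<ge> 1\<close> and \<open>w\<close> is not low.
\<close>

lemma siegel_set_covers:
  assumes "z \<in> \<H>"
  obtains A w where "det A = 1" "w \<in> siegel_set" "z = moebius A w"
proof -
  obtain B where B: "det B = 1" and
    max: "\<And>A. det A = 1 \<Longrightarrow> Im (moebius A z) \<le> Im (moebius B z)"
    using exists_highest_translate[OF assms] by blast
  \<comment> \<open>\<open>T\<close> is the shift by \<open>-k\<close> and \<open>S\<close> the inversion.\<close>
  define k where "k = round (Re (moebius B z))"
  define T where "T = mat2 1 (- k) 0 1"
  define S where "S = mat2 0 (- 1) 1 0"
  define w where "w = moebius (T ** B) z"
  have T: "det T = 1" and S: "det S = 1"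
    by (simp_all add: T_def S_def)
  have TB: "det (T ** B) = 1"
    using T B by (simp add: det_mul)
  have w: "w = moebius B z - of_int k"
    using moebius_mult[OF B assms T] by (simp add: w_def) (simp add: T_def moebius_def)
  have wH: "w \<in> \<H>"
    unfolding w_def by (rule moebius_in_upper_half_plane[OF TB assms])
  then have y: "Im w > 0"
    by (simp add: upper_half_plane_def)
  have re: "\<bar>Re w\<bar> \<le> 1/2"
    using of_int_round_abs_le[of "Re (moebius B z)"] by (simp add: w k_def abs_minus_commute)
  have "Im (moebius S w) \<le> Im w"
    using max[of "S ** (T ** B)"] moebius_mult[OF TB assms S] S TB
    by (simp add: det_mul w_def[symmetric]) (simp add: w)
  then have "Im w / (cmod w)\<^sup>2 \<le> Im w"
    using Im_moebius[OF S, of w] by (simp add: S_def)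
  moreover have "(cmod w)\<^sup>2 > 0"
    using y by auto
  ultimately have "1 \<le> (cmod w)\<^sup>2"
    using y by (simp add: field_simps)
  moreover have "(Re w)\<^sup>2 \<le> (1/2)\<^sup>2"
    using re by (metis abs_ge_zero power2_abs power_mono)
  ultimately have "(1/2)\<^sup>2 \<le> (Im w)\<^sup>2"
    unfolding cmod_power2 by (simp add: power_divide)
  then have "1/2 \<le> Im w"
    using y by (auto dest: power2_le_imp_le)
  with re have "w \<in> siegel_set"
    by (simp add: siegel_set_def)
  moreover have "z = moebius (adj2 (T ** B)) w"
    unfolding w_def using moebius_adj2[OF TB assms] by simp
  ultimately show ?thesis
    using that[of "adj2 (T ** B)" w] TB by (simp add: det_adj2)
qed

section \<open>Cusp forms are bounded\<close>

text \<open>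
  The lower left entry of \<open>A B\<^sup>-\<^sup>1\<close> is the determinant formed by the two bottom rows; it vanishes
  modulo \<open>N\<close> when the rows agree modulo \<open>N\<close>.  As there are at most \<open>N\<^sup>2\<close> rows modulo \<open>N\<close>, this is the
  form in which the finiteness of the index of \<open>\<Gamma>\<^sub>0(N)\<close> is used.
\<close>

lemma Gamma0_invariant_bottom_row:
  assumes inv: "\<And>A z. A \<in> Gamma0 N \<Longrightarrow> z \<in> \<H> \<Longrightarrow> f (moebius A z) = f z"
    and A: "det A = 1" and B: "det B = 1"
    and cong: "A $ 2 $ 1 mod int N = B $ 2 $ 1 mod int N"
      "A $ 2 $ 2 mod int N = B $ 2 $ 2 mod int N"
    and z: "z \<in> \<H>"
  shows "f (moebius A z) = f (moebius B z)"
proof -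
  define C where "C = A ** adj2 B"
  have C: "det C = 1"
    using A B by (simp add: C_def det_mul det_adj2)
  have "C $ 2 $ 1 = A $ 2 $ 1 * B $ 2 $ 2 - A $ 2 $ 2 * B $ 2 $ 1"
    by (simp add: C_def matrix_matrix_mult_def sum_2 adj2_def)
  also have "\<dots> mod int N = (B $ 2 $ 1 * B $ 2 $ 2 - B $ 2 $ 2 * B $ 2 $ 1) mod int N"
    by (intro mod_diff_cong mod_mult_cong cong refl)
  finally have "C \<in> Gamma0 N"
    using C by (simp add: Gamma0_def mod_eq_0_iff_dvd mult.commute)
  moreover have "A = C ** B"
    by (simp add: C_def matrix_mul_assoc[symmetric] adj2_mult B)
  ultimately show ?thesis
    using inv moebius_mult[OF B z C] moebius_in_upper_half_plane[OF B z] by metis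
qed

lemma continuous_on_moebius:
  assumes "det A = 1"
  shows "continuous_on \<H> (moebius A)"
proof -
  have "\<forall>z\<in>\<H>. of_int (A $ 2 $ 1) * z + of_int (A $ 2 $ 2) \<noteq> (0 :: complex)"
    using moebius_denom_nonzero[OF assms] by blast
  then show ?thesis
    unfolding moebius_def by (intro continuous_on_divide continuous_intros)
qed

lemma bounded_on_siegel_set:
  assumes cont: "continuous_on \<H> f" and cusp: "vanishes_at_cusps f" and A: "det A = 1"
  shows "bounded ((\<lambda>w. f (moebius A w)) ` siegel_set)"
proof -
  have "((\<lambda>z. f (moebius A z)) \<longlongrightarrow> 0) (filtercomap Im at_top)"
    using cusp A Gamma0_1_iff[of A] by (simp add: vanishes_at_cusps_def)
  from tendstoD[OF this, of 1]
  have "\<forall>\<^sub>F z in filtercomap Im at_top. cmod (f (moebius A z)) < 1"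
    by simp
  then obtain Y where Y: "\<And>z. Im z \<ge> Y \<Longrightarrow> cmod (f (moebius A z)) < 1"
    by (auto simp: eventually_filtercomap eventually_at_top_linorder)
  define K where "K = cbox (Complex (-1/2) (1/2)) (Complex (1/2) Y)"
  have "K \<subseteq> \<H>"
    by (auto simp: K_def in_cbox_complex_iff upper_half_plane_def)
  then have "continuous_on K (\<lambda>w. f (moebius A w))"
    using continuous_on_subset[OF continuous_on_moebius[OF A]] moebius_in_upper_half_plane[OF A]
    by (intro continuous_on_compose2[OF cont]) auto
  then have "bounded ((\<lambda>w. f (moebius A w)) ` K)"
    unfolding K_def by (intro compact_imp_bounded compact_continuous_image compact_cbox)
  moreover have "(\<lambda>w. f (moebius A w)) ` siegel_set \<subseteq> (\<lambda>w. f (moebius A w)) ` K \<union> ball 0 1"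
  proof safe
    fix w assume w: "w \<in> siegel_set" "f (moebius A w) \<notin> ball 0 1"
    then have "Im w \<le> Y"
      using Y[of w] by (cases "Im w \<le> Y") auto
    then have "w \<in> K"
      using w by (auto simp: K_def in_cbox_complex_iff siegel_set_def)
    then show "f (moebius A w) \<in> (\<lambda>w. f (moebius A w)) ` K"
      by blast
  qed
  ultimately show ?thesis
    by (meson bounded_Un bounded_ball bounded_subset)
qed

text \<open>
  The values of \<open>f\<close> on \<open>\<H>\<close> are covered by the sets \<open>F A = f (A S)\<close>, with \<open>S\<close> the Siegel set and
  \<open>A \<in> SL\<^sub>2(\<int>)\<close>.  These are grouped by the bottom row of \<open>A\<close> modulo \<open>N\<close>: within a group they are
  equal, and there are finitely many groups.
\<close>

lemma maass_cusp_form_bounded: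
  assumes "N > 0" and f: "maass_cusp_form N l f"
  shows "bounded (f ` \<H>)"
proof -
  have cont: "continuous_on \<H> f"
    using f unfolding maass_cusp_form_def smooth_on_def
    by (metis higher_differentiable_on.simps(1))
  have cusp: "vanishes_at_cusps f"
    and inv: "\<And>A z. A \<in> Gamma0 N \<Longrightarrow> z \<in> \<H> \<Longrightarrow> f (moebius A z) = f z"
    using f by (auto simp: maass_cusp_form_def)
  define r where "r = (\<lambda>A :: int^2^2. (A $ 2 $ 1 mod int N, A $ 2 $ 2 mod int N))"
  define F where "F = (\<lambda>A. (\<lambda>w. f (moebius A w)) ` siegel_set)"
  have F: "F A = F B" if "det A = 1" "det B = 1" "r A = r B" for A B
    unfolding F_def
  proof (rule image_cong[OF refl])
    fix w assume "w \<in> siegel_set"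
    then show "f (moebius A w) = f (moebius B w)"
      using that siegel_set_subset
      by (intro Gamma0_invariant_bottom_row[of N f A B]) (auto simp: inv r_def)
  qed
  define R where "R = r ` {A. det A = 1}"
  have "finite R"
    using assms(1) by (intro finite_subset[of R "{0..<int N} \<times> {0..<int N}"]) (auto simp: R_def r_def)
  moreover have "bounded (\<Union>A \<in> {A. det A = 1 \<and> r A = v}. F A)" if "v \<in> R" for v
  proof -
    from that obtain B where B: "det B = 1" "r B = v"
      by (auto simp: R_def)
    then have "(\<Union>A \<in> {A. det A = 1 \<and> r A = v}. F A) = F B"
      using F by blast
    then show ?thesis
      using bounded_on_siegel_set[OF cont cusp B(1)] by (simp add: F_def)
  qed
  ultimately have "bounded (\<Union>v\<in>R. \<Union>A \<in> {A. det A = 1 \<and> r A = v}. F A)"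
    by (intro bounded_UN) auto
  moreover have "f ` \<H> \<subseteq> (\<Union>v\<in>R. \<Union>A \<in> {A. det A = 1 \<and> r A = v}. F A)"
  proof safe
    fix z assume "z \<in> \<H>"
    then obtain A w where "det A = 1" "w \<in> siegel_set" "z = moebius A w"
      by (rule siegel_set_covers)
    then show "f z \<in> (\<Union>v\<in>R. \<Union>A \<in> {A. det A = 1 \<and> r A = v}. F A)"
      by (auto simp: R_def F_def)
  qed
  ultimately show ?thesis
    by (rule bounded_subset)
qed

section \<open>Bounds for Hecke eigenvalues\<close>

definition hecke_pairs :: "nat \<Rightarrow> nat \<Rightarrow> (nat \<times> nat) set" where
  "hecke_pairs N n = {(a, d). a * d = n \<and> d > 0 \<and> coprime a N}"

definition hecke_bound :: "nat \<Rightarrow> nat \<Rightarrow> real" where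
  "hecke_bound N n = (\<Sum>(a, d) \<in> hecke_pairs N n. real d) / sqrt (real n)"

lemma hecke_bound_nonneg: "hecke_bound N n \<ge> 0"
  by (auto simp: hecke_bound_def intro!: divide_nonneg_nonneg sum_nonneg)

lemma norm_hecke_le:
  assumes "n \<ge> 1" "z \<in> \<H>" and bd: "\<And>w. w \<in> \<H> \<Longrightarrow> cmod (f w) \<le> S"
  shows "cmod (hecke N n f z) \<le> hecke_bound N n * S"
proof -
  have in_H: "(of_nat a * z + of_nat b) / of_nat d \<in> \<H>" if "(a, d) \<in> hecke_pairs N n" for a b d
  proof -
    have "a > 0" "d > 0"
      using that assms(1) by (auto simp: hecke_pairs_def intro!: Nat.gr0I)
    moreover have "Im ((of_nat a * z + of_nat b) / of_nat d) = real a * Im z / real d"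
      using Im_divide_of_nat[of "of_nat a * z + of_nat b" d] by simp
    ultimately show ?thesis
      using assms(2) by (simp add: upper_half_plane_def)
  qed
  have "cmod (\<Sum>(a, d) \<in> hecke_pairs N n. \<Sum>b<d. f ((of_nat a * z + of_nat b) / of_nat d))
      \<le> (\<Sum>(a, d) \<in> hecke_pairs N n. real d * S)"
  proof (rule sum_norm_le, clarify)
    fix a d assume ad: "(a, d) \<in> hecke_pairs N n"
    have "cmod (\<Sum>b<d. f ((of_nat a * z + of_nat b) / of_nat d)) \<le> (\<Sum>b<d. S)"
      by (intro sum_norm_le bd in_H[OF ad])
    then show "cmod (\<Sum>b<d. f ((of_nat a * z + of_nat b) / of_nat d)) \<le> real d * S"
      by simp
  qed
  also have "\<dots> = (\<Sum>(a, d) \<in> hecke_pairs N n. real d) * S"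
    by (simp add: sum_distrib_right case_prod_unfold)
  finally show ?thesis
    unfolding hecke_def hecke_pairs_def[symmetric]
    by (simp add: norm_mult norm_divide hecke_bound_def divide_right_mono)
qed

lemma hecke_eigenvalue_bound:
  assumes "bounded (f ` \<H>)" "z0 \<in> \<H>" "f z0 \<noteq> 0" "n \<ge> 1"
    and eig: "hecke N n f = scale_fun (of_real t) f"
  shows "\<bar>t\<bar> \<le> hecke_bound N n"
proof (cases "t = 0")
  case True
  then show ?thesis
    by (simp add: hecke_bound_nonneg)
next
  case False
  define S where "S = (SUP w\<in>\<H>. cmod (f w))"
  have bdd: "bdd_above ((\<lambda>w. cmod (f w)) ` \<H>)"
    using assms(1) unfolding bounded_iff bdd_above_def by blast
  have le: "cmod (f w) \<le> S" if "w \<in> \<H>" for w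
    unfolding S_def using that bdd by (rule cSUP_upper)
  have "S > 0"
    using le[OF assms(2)] assms(3) by (smt (verit) zero_less_norm_iff)
  have "cmod (f w) \<le> hecke_bound N n * S / \<bar>t\<bar>" if "w \<in> \<H>" for w
  proof -
    have "\<bar>t\<bar> * cmod (f w) = cmod (hecke N n f w)"
      by (simp add: eig scale_fun_def norm_mult)
    also have "\<dots> \<le> hecke_bound N n * S"
      using assms(4) that le by (rule norm_hecke_le)
    finally show ?thesis
      using False by (simp add: field_simps)
  qed
  then have "S \<le> hecke_bound N n * S / \<bar>t\<bar>"
    unfolding S_def using assms(2) by (intro cSUP_least) auto
  then show ?thesis
    using \<open>S > 0\<close> False by (simp add: field_simps)
qed

lemma basis_hecke_eigenvalue_bound:
  assumes "N > 0" and basis: "maass_newform_basis N f lam a" and "n \<ge> 1"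
  shows "\<bar>a j n\<bar> \<le> hecke_bound N n"
proof -
  have "f j \<noteq> 0"
    using basis fun_space.dependent_zero unfolding maass_newform_basis_def by (metis rangeI)
  then have form: "maass_cusp_form N (of_real (lam j)) (f j)"
    using basis by (auto simp: maass_newform_basis_def newform_space_def)
  obtain z where z: "f j z \<noteq> 0"
    using \<open>f j \<noteq> 0\<close> by (auto simp: fun_eq_iff)
  then have "z \<in> \<H>"
    using form by (auto simp: maass_cusp_form_def)
  moreover have "hecke N n (f j) = scale_fun (of_real (a j n)) (f j)"
    using basis assms(3) by (simp add: maass_newform_basis_def)
  ultimately show ?thesis
    using hecke_eigenvalue_bound maass_cusp_form_bounded[OF assms(1) form] z assms(3) by blast
qed

section \<open>Eigenvalues near the approximate ones\<close>

theorem mainTheorem1: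
  fixes N M :: nat
    and f :: "nat \<Rightarrow> complex \<Rightarrow> complex"
    and lam :: "nat \<Rightarrow> real"
    and a :: "nat \<Rightarrow> nat \<Rightarrow> real"
    and H :: "real \<Rightarrow> real"
    and Q Qt :: "nat \<Rightarrow> nat \<Rightarrow> real"
    and lamt \<epsilon> :: real
    and c :: "nat \<Rightarrow> real"
  assumes "N > 0" and "squarefree N"
    and "maass_newform_basis N f lam a"
    and "M \<ge> 1"
    and "\<And>x. x > 0 \<Longrightarrow> H x \<ge> 0"
    and "admissible N lam a H"
    and "symmetric_matrix_of_form (index_set N M) (\<lambda>x. quad_form lam a M x H) Q"
    and "symmetric_matrix_of_form (index_set N M) (\<lambda>x. quad_form lam a M x (\<lambda>t. t * H t)) Qt"
    and "positive_definite (index_set N M) Q"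
    and "generalised_eigenpair (index_set N M) Qt Q lamt c"
    and "\<And>m. m \<notin> index_set N M \<Longrightarrow> c m = 0"
    and "\<epsilon> = sqrt (quad_form lam a M c (\<lambda>t. H t * (t - lamt)\<^sup>2) / quad_form lam a M c H)"
  shows "\<exists>l \<in> range lam. l \<in> {lamt - \<epsilon> .. lamt + \<epsilon>}"
proof -
  note basis = assms(3) and adm = assms(6)
  have lam_pos: "lam j > 0" and a1: "a j 1 = 1" for j
    using basis by (auto simp: maass_newform_basis_def)
  have H0: "H (lam j) \<ge> 0" for j
    using assms(5) lam_pos by blast
  define s where "s = (\<lambda>j. \<Sum>m=1..M. c m * a j m)"
  define w where "w = (\<lambda>j. (s j)\<^sup>2 * H (lam j))"
  define K where "K = (\<Sum>m=1..M. \<bar>c m\<bar> * hecke_bound N m)"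
  have s_bound: "\<bar>s j\<bar> \<le> K" for j
  proof -
    have "\<bar>c m * a j m\<bar> \<le> \<bar>c m\<bar> * hecke_bound N m" if "m \<in> {1..M}" for m
      using basis_hecke_eigenvalue_bound[OF assms(1) basis, of m j] that
      by (simp add: abs_mult mult_left_mono)
    then show ?thesis
      unfolding s_def K_def by (intro order_trans[OF sum_abs] sum_mono)
  qed
  have s2: "(s j)\<^sup>2 \<le> K\<^sup>2" for j
    using s_bound[of j] by (metis abs_ge_zero power2_abs power_mono)
  have summ: "summable (\<lambda>j. (s j)\<^sup>2 * g j)" if "summable (\<lambda>j. \<bar>g j\<bar>)" for g
  proof (rule summable_comparison_test')
    show "summable (\<lambda>j. K\<^sup>2 * \<bar>g j\<bar>)"
      using that by (rule summable_mult)
    show "norm ((s j)\<^sup>2 * g j) \<le> K\<^sup>2 * \<bar>g j\<bar>" for j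
      using s2[of j] by (simp add: abs_mult mult_right_mono)
  qed
  have "summable (\<lambda>j. \<bar>H (lam j)\<bar>)" "summable (\<lambda>j. \<bar>lam j * H (lam j)\<bar>)"
    "summable (\<lambda>j. \<bar>(lam j)\<^sup>2 * H (lam j)\<bar>)"
    using adm[unfolded admissible_def, rule_format, of 1] by (simp_all add: a1[simplified])
  note S = this[THEN summ]
  have sw: "summable w"
    using S(1) by (simp add: w_def)
  have sv: "summable (\<lambda>j. w j * (lam j - lamt)\<^sup>2)"
  proof -
    have "summable (\<lambda>j. (s j)\<^sup>2 * ((lam j)\<^sup>2 * H (lam j)) - 2 * lamt * ((s j)\<^sup>2 * (lam j * H (lam j)))
        + lamt\<^sup>2 * ((s j)\<^sup>2 * H (lam j)))"
      by (intro summable_add summable_diff summable_mult S)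
    then show ?thesis
      by (simp add: w_def power2_eq_square algebra_simps)
  qed
  have q: "quad_form lam a M c H = suminf w"
    by (simp add: quad_form_def w_def s_def)
  have v: "quad_form lam a M c (\<lambda>t. H t * (t - lamt)\<^sup>2) = (\<Sum>j. w j * (lam j - lamt)\<^sup>2)"
    by (simp add: quad_form_def w_def s_def mult.assoc)
  have "\<exists>m\<in>index_set N M. c m \<noteq> 0"
    using assms(10) by (simp add: generalised_eigenpair_def)
  then have "(\<Sum>m\<in>index_set N M. \<Sum>n\<in>index_set N M. c m * Q m n * c n) > 0"
    using assms(9) by (simp add: positive_definite_def)
  moreover have "quad_form lam a M c H = (\<Sum>m\<in>index_set N M. \<Sum>n\<in>index_set N M. c m * Q m n * c n)"
    using assms(7,11) unfolding symmetric_matrix_of_form_def by blast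
  ultimately have "suminf w > 0"
    by (simp add: q)
  moreover have "w j \<ge> 0" for j
    using H0 by (simp add: w_def)
  ultimately obtain j where "\<bar>lam j - lamt\<bar> \<le> \<epsilon>"
    using exists_within_rms_deviation[of w lam lamt] sw sv unfolding assms(12) q v by blast
  then show ?thesis
    by (intro bexI[of _ "lam j"]) (auto simp: abs_le_iff)
qed

end
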